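(* There is a universal constant $c_0>0$ (independent of $n$ and of all the data below) with the following property. Let $A\in\mathbb{K}^{n\times n}$ be a nonzero matrix, and let $(\lambda,v)$, $(\lambda_0,v_0)$ be in $\mathbb{K}\times\mathbb{P}(\mathbb{K}^n)$. If $(A,\lambda,v)\in\mathcal{W}$ and $$ d_{\mathbb{P}^2}\big((A,\lambda_0,v_0),(A,\lambda,v)\big)<\frac{c_0}{\mu(A,\lambda,v)}, $$ then $(A,\lambda_0,v_0)$ is an approximate solution of $(A,\lambda,v)$. (One may choose $c_0=0.0739$.)
   Context: $\mathbb{K}$ denotes $\mathbb{R}$ or $\mathbb{C}$ and $n\ge 2$. $\mathbb{P}(\mathbb{E})$ is the projective space of a vector space $\mathbb{E}$ over $\mathbb{K}$; points of projective spaces are denoted by nonzero representatives. $\mathbb{K}^n$ has its canonical Hermitian product, $\mathbb{K}^{n\times n}$ the Frobenius product $\langle A,B\rangle_F=\mathrm{trace}(B^*A)$ with norm $\|\cdot\|_F$, $\mathbb{K}^{n\times n}\times\mathbb{K}$ the product Hermitian structure, and $\|\cdot\|$ is the operator norm on linear maps. $\mathcal{V}=\{(A,\lambda,v)\in\mathbb{P}(\mathbb{K}^{n\times n}\times\mathbb{K})\times\mathbb{P}(\mathbb{K}^n):(\lambda I_n-A)v=0\}$, and $\mathcal{W}\subset\mathcal{V}$ is the set of triples for which $\lambda$ is a simple eigenvalue of $A$. $\Pi_{v^\perp}$ is the orthogonal projection onto the Hermitian complement $v^\perp$ of $v$ in $\mathbb{K}^n$; for $(A,\lambda,v)\in\mathcal{W}$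 the operator $\Pi_{v^\perp}(\lambda I_n-A)|_{v^\perp}:v^\perp\to v^\perp$ is invertible, and $\mu(A,\lambda,v)=\max\{1,\|A\|_F\|(\Pi_{v^\perp}(\lambda I_n-A)|_{v^\perp})^{-1}\|\}$. Distances: $d_{\mathbb{P}}(x,y)=\arccos\frac{|\langle x,y\rangle|}{\|x\|\|y\|}$ on the projective space of a Hermitian space, and $d_{\mathbb{P}^2}((A,\lambda,v),(A',\lambda',v'))=\big(d_{\mathbb{P}}((A,\lambda),(A',\lambda'))^2+d_{\mathbb{P}}(v,v')^2\big)^{1/2}$ on $\mathbb{P}(\mathbb{K}^{n\times n}\times\mathbb{K})\times\mathbb{P}(\mathbb{K}^n)$. Newton map: for nonzero $A$ let $F_A(\lambda,v)=(\lambda I_n-A)v$ on $\mathbb{K}\times\mathbb{K}^n$, with derivative $DF_A(\lambda,v)(\dot\lambda,\dot v)=\dot\lambda v+(\lambda I_n-A)\dot v$. The Newton map is $N_A(\lambda,v)=(\lambda,v)-\big(DF_A(\lambda,v)|_{\mathbb{K}\times v^\perp}\big)^{-1}F_A(\lambda,v)$, defined for those $(\lambda,v)$, $v\ne0$, at which $DF_A(\lambda,v)|_{\mathbb{K}\times v^\perp}$ is invertible; it induces a partially defined map from $\mathbb{K}\times\mathbb{P}(\mathbb{K}^n)$ to itself. Given $(A,\lambda,v)\in\mathcal{V}$, the triple $(A,\lambda_0,v_0)$ is an approximate solution of $(A,\lambda,v)$ if the sequence $(A,N_A^k(\lambda_0,v_0))$, $k=0,1,2,\ldots$, is defined and satisfies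 $d_{\mathbb{P}^2}\big((A,N_A^k(\lambda_0,v_0)),(A,\lambda,v)\big)\le\left(\tfrac12\right)^{2^k-1}d_{\mathbb{P}^2}\big((A,\lambda_0,v_0),(A,\lambda,v)\big)$ for all positive integers $k$. *)

theory Defs
  imports "HOL-Analysis.Analysis" "HOL-Computational_Algebra.Polynomial"
    "Jordan_Normal_Form.Conjugate"
begin

text \<open>
  The definitions are polymorphic in the scalar type and are meant for the two types
  \<^typ>\<open>real\<close> and \<^typ>\<open>complex\<close>, where \<^const>\<open>conjugate\<close> is the identity and complex
  conjugation, respectively. The library norms on vectors, matrices and pairs are the ones
  induced by the Hermitian products below; in particular the norm of a matrix is its
  Frobenius norm (see the lemmas \<open>herm_self\<close>, \<open>frob_self\<close> and \<open>pair_self\<close>).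
  Points of projective spaces are represented by nonzero vectors.
\<close>

definition herm :: "'k::{real_normed_field,conjugatable_field}^'n \<Rightarrow> 'k^'n \<Rightarrow> 'k" where
  "herm x y = (\<Sum>i\<in>UNIV. x $ i * conjugate (y $ i))"

definition conj_transpose :: "'k::{real_normed_field,conjugatable_field}^'n^'m \<Rightarrow> 'k^'m^'n" where
  "conj_transpose B = (\<chi> i j. conjugate (B $ j $ i))"

definition frob :: "'k::{real_normed_field,conjugatable_field}^'n^'n \<Rightarrow> 'k^'n^'n \<Rightarrow> 'k" where
  "frob A B = trace (conj_transpose B ** A)"

definition herm_pair ::
  "('k::{real_normed_field,conjugatable_field}^'n^'n) \<times> 'k \<Rightarrow> ('k^'n^'n) \<times> 'k \<Rightarrow> 'k" where
  "herm_pair x y = frob (fst x) (fst y) + snd x * conjugate (snd y)"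

lemma herm_self:
  shows "herm (x :: real^'n) x = (norm x)\<^sup>2"
    and "herm (y :: complex^'n) y = of_real ((norm y)\<^sup>2)"
proof -
  show "herm x x = (norm x)\<^sup>2"
    by (simp add: herm_def norm_vec_def L2_set_def sum_nonneg power2_eq_square[of "x $ _"])
  show "herm y y = of_real ((norm y)\<^sup>2)"
    by (simp add: herm_def norm_vec_def L2_set_def sum_nonneg complex_norm_square
        del: of_real_power)
qed

lemma frob_eq_sum:
  "frob A B = (\<Sum>i\<in>UNIV. \<Sum>j\<in>UNIV. A $ i $ j * conjugate (B $ i $ j))"
  unfolding frob_def trace_def conj_transpose_def matrix_matrix_mult_def
  by (subst sum.swap) (simp add: mult.commute)

lemma frob_self:
  shows "frob (A :: real^'n^'n) A = (norm A)\<^sup>2"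
    and "frob (B :: complex^'n^'n) B = of_real ((norm B)\<^sup>2)"
proof -
  have "frob A A = (\<Sum>i\<in>UNIV. herm (A $ i) (A $ i))"
    by (simp add: frob_eq_sum herm_def)
  then show "frob A A = (norm A)\<^sup>2"
    by (simp add: herm_self norm_vec_def[of A] L2_set_def sum_nonneg)
  have "frob B B = (\<Sum>i\<in>UNIV. herm (B $ i) (B $ i))"
    by (simp add: frob_eq_sum herm_def)
  then show "frob B B = of_real ((norm B)\<^sup>2)"
    by (simp add: herm_self norm_vec_def[of B] L2_set_def sum_nonneg del: of_real_power)
qed

lemma pair_self:
  shows "herm_pair (x :: (real^'n^'n) \<times> real) x = (norm x)\<^sup>2"
    and "herm_pair (y :: (complex^'n^'n) \<times> complex) y = of_real ((norm y)\<^sup>2)"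
proof -
  show "herm_pair x x = (norm x)\<^sup>2"
    by (simp add: herm_pair_def frob_self norm_prod_def power2_eq_square[of "snd x"])
  show "herm_pair y y = of_real ((norm y)\<^sup>2)"
    by (simp add: herm_pair_def frob_self norm_prod_def complex_norm_square del: of_real_power)
qed

text \<open>The distance on the projective space of a space with Hermitian product \<open>h\<close>.\<close>

definition proj_dist ::
  "('a::real_normed_vector \<Rightarrow> 'a \<Rightarrow> 'k::real_normed_field) \<Rightarrow> 'a \<Rightarrow> 'a \<Rightarrow> real" where
  "proj_dist h x y = arccos (norm (h x y) / (norm x * norm y))"

definition dist_P2 ::
  "('k::{real_normed_field,conjugatable_field}^'n^'n) \<times> 'k \<times> ('k^'n)
    \<Rightarrow> ('k^'n^'n) \<times> 'k \<times> ('k^'n) \<Rightarrow> real" where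
  "dist_P2 = (\<lambda>(A, l, v) (A', l', v').
     sqrt ((proj_dist herm_pair (A, l) (A', l'))\<^sup>2 + (proj_dist herm v v')\<^sup>2))"

definition charpoly :: "'k::field^'n^'n \<Rightarrow> 'k poly" where
  "charpoly A = det (mat [:0, 1:] - map_matrix (\<lambda>a. [:a:]) A)"

definition simple_eigenvalue :: "'k::field^'n^'n \<Rightarrow> 'k \<Rightarrow> bool" where
  "simple_eigenvalue A l \<longleftrightarrow> order l (charpoly A) = 1"

definition solution_variety ::
  "(('k::{real_normed_field,conjugatable_field}^'n^'n) \<times> 'k \<times> ('k^'n)) set" where
  "solution_variety =
     {(A, l, v). (A, l) \<noteq> (0, 0) \<and> v \<noteq> 0 \<and> (mat l - A) *v v = 0}"

definition well_posed ::
  "(('k::{real_normed_field,conjugatable_field}^'n^'n) \<times> 'k \<times> ('k^'n)) set" where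
  "well_posed = {(A, l, v). (A, l, v) \<in> solution_variety \<and> simple_eigenvalue A l}"

definition perp :: "'k::{real_normed_field,conjugatable_field}^'n \<Rightarrow> ('k^'n) set" where
  "perp v = {w. herm w v = 0}"

definition perp_proj :: "'k::{real_normed_field,conjugatable_field}^'n \<Rightarrow> 'k^'n \<Rightarrow> 'k^'n" where
  "perp_proj v w = w - (herm w v / herm v v) *s v"

text \<open>The operator norm of a linear map defined on a subspace \<open>S\<close>; compare \<^const>\<open>onorm\<close>.\<close>

definition onorm_on ::
  "'a::real_normed_vector set \<Rightarrow> ('a \<Rightarrow> 'b::real_normed_vector) \<Rightarrow> real" where
  "onorm_on S f = (SUP x\<in>S. norm (f x) / norm x)"

definition cond_op ::
  "'k::{real_normed_field,conjugatable_field}^'n^'n \<Rightarrow> 'k \<Rightarrow> 'k^'n \<Rightarrow> 'k^'n \<Rightarrow> 'k^'n" where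
  "cond_op A l v w = perp_proj v ((mat l - A) *v w)"

definition cond_number ::
  "('k::{real_normed_field,conjugatable_field}^'n^'n) \<times> 'k \<times> ('k^'n) \<Rightarrow> real" where
  "cond_number = (\<lambda>(A, l, v).
     max 1 (norm A * onorm_on (perp v) (inv_into (perp v) (cond_op A l v))))"

definition eig_map ::
  "'k::{real_normed_field,conjugatable_field}^'n^'n \<Rightarrow> 'k \<times> ('k^'n) \<Rightarrow> 'k^'n" where
  "eig_map A = (\<lambda>(l, v). (mat l - A) *v v)"

definition eig_deriv ::
  "'k::{real_normed_field,conjugatable_field}^'n^'n \<Rightarrow> 'k \<times> ('k^'n) \<Rightarrow> 'k \<times> ('k^'n) \<Rightarrow> 'k^'n"
where
  "eig_deriv A = (\<lambda>(l, v) (dl, dv). dl *s v + (mat l - A) *v dv)"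

definition newton_domain ::
  "'k::{real_normed_field,conjugatable_field}^'n^'n \<Rightarrow> ('k \<times> ('k^'n)) set" where
  "newton_domain A =
     {(l, v). v \<noteq> 0 \<and> bij_betw (eig_deriv A (l, v)) (UNIV \<times> perp v) UNIV}"

text \<open>The value is only meaningful on \<^const>\<open>newton_domain\<close>. Scaling \<open>v\<close> scales the second
  component of the result, so this induces a map on the scalars times projective space.\<close>

definition newton ::
  "'k::{real_normed_field,conjugatable_field}^'n^'n \<Rightarrow> 'k \<times> ('k^'n) \<Rightarrow> 'k \<times> ('k^'n)" where
  "newton A = (\<lambda>(l, v).
     (l, v) - inv_into (UNIV \<times> perp v) (eig_deriv A (l, v)) (eig_map A (l, v)))"

text \<open>The triple \<open>(A, x0)\<close> is an approximate solution of \<open>(A, x)\<close>. All iterates are defined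
  if and only if each of them lies in the domain of the Newton map.\<close>

definition approx_solution ::
  "'k::{real_normed_field,conjugatable_field}^'n^'n
    \<Rightarrow> 'k \<times> ('k^'n) \<Rightarrow> 'k \<times> ('k^'n) \<Rightarrow> bool" where
  "approx_solution A x0 x \<longleftrightarrow>
     (A, x) \<in> solution_variety \<and>
     (\<forall>k. (newton A ^^ k) x0 \<in> newton_domain A) \<and>
     (\<forall>k\<ge>1. dist_P2 (A, (newton A ^^ k) x0) (A, x)
        \<le> (1/2) ^ (2 ^ k - 1) * dist_P2 (A, x0) (A, x))"

end

theory Submission
  imports Defs
begin

text \<open>
  Newton's method for the eigenvalue equation \<open>(l I - A) v = 0\<close> converges quadratically because
  the equation is quadratic: its only nonlinear term is the product \<open>l v\<close>. Scale the exact
  eigenvector so that it becomes \<open>v0 + u\<close> with \<open>u\<close> orthogonal to \<open>v0\<close>. The error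
  \<open>(l1 - l, e)\<close> of one Newton step from \<open>(l0, v0)\<close> then satisfies exactly

  \<open>(l1 - l) v0 + (l0 I - A) e = - (l0 - l) u\<close> with \<open>e\<close> orthogonal to \<open>v0\<close>.

  The right-hand side is a product of two first-order errors. What remains is to
  bound the inverse of the projection of \<open>l0 I - A\<close> to the complement of \<open>v0\<close>. At the eigenpair
  \<open>(l, v)\<close> itself the condition number \<open>\<mu>\<close> bounds it by \<open>\<mu> / norm A\<close>
  (\<open>norm_le_cond_number\<close>), and at distance less than \<open>0.0739 / \<mu>\<close> the bound deteriorates only by a constant factor
  (\<open>inverse_bound_near_eigenvector\<close>).

  Distances are compared with these Euclidean errors through the sines of the angles. Writing \<open>d\<close>
  for the distance before the step, \<open>a\<close> and \<open>b\<close> for its two components and \<open>N\<close> for the norm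
  of \<open>A\<close>, one has \<open>norm (l0 - l) \<le> 2.24 N a\<close> and \<open>norm u \<le> 1.01 b * norm v0\<close>, while both angles
  after the step have sine at most \<open>norm e / norm v0\<close>. With \<open>2 a b \<le> d\<^sup>2\<close> this shows that the
  distance after the step is at most \<open>6.7 \<mu> d\<^sup>2\<close> (\<open>newton_step\<close>). As \<open>6.7 * 0.0739 < 1 / 2\<close>,
  iterating gives the exponents \<open>2 ^ k - 1\<close>.

  The norm in the condition number is a supremum of quotients, which is an actual bound only if
  the operator it inverts is bijective on the complement of \<open>v\<close>. That is where simplicity of the
  eigenvalue enters: a kernel vector there would give a double root of the
  characteristic polynomial (\<open>simple_eigenvalue_no_generalized_eigenvector\<close>).
\<close>

section \<open>Hermitian geometry over the real and complex numbers\<close>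

text \<open>
  The real and the complex theorem have one proof. Beyond the laws of a normed field with
  an involution it uses that the involution \<open>conjugate\<close> is tied to the norm and that the scalars
  are a finite-dimensional real space, so that injective linear endomorphisms of the space of vectors
  are surjective and bounded below.
\<close>

class hermitian_scalar = real_normed_field + conjugatable_field + euclidean_space +
  assumes mult_conjugate_self_scaleR: "x * conjugate x = (norm x)\<^sup>2 *\<^sub>R 1"

instance real :: hermitian_scalar
  by standard (simp add: power2_eq_square)

instance complex :: hermitian_scalar
  by standard (simp add: complex_norm_square[symmetric] scaleR_conv_of_real del: of_real_power)

lemma mult_conjugate_self: "x * conjugate x = of_real ((norm (x::'k::hermitian_scalar))\<^sup>2)"
  by (simp add: mult_conjugate_self_scaleR of_real_def)

lemma norm_conjugate [simp]: "norm (conjugate (x::'k::hermitian_scalar)) = norm x"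
proof (cases "x = 0")
  case False
  have "norm x * norm (conjugate x) = norm x * norm x"
    using arg_cong[OF mult_conjugate_self[of x], of norm]
    by (simp add: norm_mult power2_eq_square)
  with False show ?thesis by simp
qed simp

lemma conjugate_of_real [simp]: "conjugate (of_real r :: 'k::hermitian_scalar) = of_real r"
proof (cases "r = 0")
  case False
  have "of_real r * conjugate (of_real r :: 'k) = of_real r * of_real r"
    by (simp add: mult_conjugate_self power2_eq_square)
  with False show ?thesis by simp
qed simp

lemma conjugate_diff: "conjugate (x - y) = conjugate x - conjugate (y::'k::hermitian_scalar)"
  using conjugate_dist_add[of x "- y"] by (simp add: conjugate_neg)

lemma scaleR_vec_eq: "r *\<^sub>R (x::'k::hermitian_scalar^'n) = of_real r *s x"
  by (simp add: vec_eq_iff scaleR_conv_of_real[where 'a='k, symmetric])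

lemma norm_vector_smult: "norm (c *s (x::'k::hermitian_scalar^'n)) = norm c * norm x"
  by (simp add: norm_vec_def norm_mult L2_set_right_distrib)

lemma mat_mult_vec: "mat l *v x = l *s (x::'k::comm_ring_1^'n)"
  by (simp add: vec_eq_iff matrix_vector_mult_def mat_def if_distrib[of "\<lambda>c. c * _"] cong: if_cong)

lemma mat_diff_mult_vec: "(mat l - A) *v x = l *s x - A *v (x::'k::comm_ring_1^'n)"
  by (simp add: matrix_vector_mult_diff_rdistrib mat_mult_vec)

lemma herm_add_left: "herm (x + y) z = herm x z + herm y z"
  by (simp add: herm_def sum.distrib distrib_right)

lemma herm_diff_left: "herm (x - y) z = herm x z - herm y z"
  by (simp add: herm_def sum_subtractf left_diff_distrib)

lemma herm_scale_left: "herm (c *s x) z = c * herm x z"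
  by (simp add: herm_def sum_distrib_left mult.assoc)

lemma herm_zero_left [simp]: "herm 0 z = 0"
  by (simp add: herm_def)

lemma conjugate_herm: "conjugate (herm x y) = herm y (x::'k::hermitian_scalar^'n)"
  by (simp add: herm_def sum_conjugate conjugate_dist_mul mult.commute)

lemma norm_herm_commute: "norm (herm x y) = norm (herm y (x::'k::hermitian_scalar^'n))"
  by (simp add: conjugate_herm[of x y, symmetric])

lemma herm_add_right: "herm z (x + y) = herm z x + herm z (y::'k::hermitian_scalar^'n)"
  by (simp add: conjugate_herm[of _ z, symmetric] herm_add_left conjugate_dist_add)

lemma herm_scale_right: "herm z (c *s x) = conjugate c * herm z (x::'k::hermitian_scalar^'n)"
  by (simp add: conjugate_herm[of _ z, symmetric] herm_scale_left conjugate_dist_mul)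

lemma herm_same: "herm x x = of_real ((norm (x::'k::hermitian_scalar^'n))\<^sup>2)"
  by (simp add: herm_def mult_conjugate_self norm_vec_def L2_set_def sum_nonneg del: of_real_power)

lemma herm_same_eq_0_iff [simp]: "herm x x = 0 \<longleftrightarrow> (x::'k::hermitian_scalar^'n) = 0"
  by (simp add: herm_same)

lemma herm_Cauchy_Schwarz: "norm (herm x y) \<le> norm x * norm (y::'k::hermitian_scalar^'n)"
proof -
  have "norm (herm x y) \<le> (\<Sum>i\<in>UNIV. \<bar>norm (x $ i)\<bar> * \<bar>norm (y $ i)\<bar>)"
    unfolding herm_def by (rule order_trans[OF norm_sum]) (simp add: norm_mult)
  also have "\<dots> \<le> norm x * norm y"
    unfolding norm_vec_def by (rule L2_set_mult_ineq)
  finally show ?thesis .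
qed

lemma herm_Pythagoras:
  fixes x y :: "'k::hermitian_scalar^'n"
  assumes "herm x y = 0"
  shows "(norm (x + y))\<^sup>2 = (norm x)\<^sup>2 + (norm y)\<^sup>2"
proof -
  have "herm y x = 0"
    using assms by (simp add: conjugate_herm[of x y, symmetric])
  then have "(of_real ((norm (x + y))\<^sup>2) :: 'k) = of_real ((norm x)\<^sup>2 + (norm y)\<^sup>2)"
    using assms unfolding herm_same[symmetric] of_real_add
    by (simp add: herm_add_left herm_add_right)
  then show ?thesis by (simp only: of_real_eq_iff)
qed

text \<open>
  The norm of a matrix type is the Frobenius norm, which dominates the operator norm:
  apply the Cauchy-Schwarz inequality to each row.
\<close>

lemma norm_matrix_vector_mult_le:
  "norm (A *v x) \<le> norm A * norm (x::'k::hermitian_scalar^'n)"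
proof -
  have row: "norm ((A *v x) $ i) \<le> norm (A $ i) * norm x" for i
  proof -
    have "norm ((A *v x) $ i) \<le> (\<Sum>j\<in>UNIV. \<bar>norm (A $ i $ j)\<bar> * \<bar>norm (x $ j)\<bar>)"
      unfolding matrix_vector_mult_def vec_lambda_beta
      by (rule order_trans[OF norm_sum]) (simp add: norm_mult)
    also have "\<dots> \<le> norm (A $ i) * norm x"
      unfolding norm_vec_def[of "A $ i"] norm_vec_def[of x] by (rule L2_set_mult_ineq)
    finally show ?thesis .
  qed
  have "norm (A *v x) \<le> L2_set (\<lambda>i. norm (A $ i) * norm x) UNIV"
    unfolding norm_vec_def[of "A *v x"] by (rule L2_set_mono) (use row in auto)
  also have "\<dots> = norm A * norm x"
    by (simp add: norm_vec_def[of A] L2_set_left_distrib)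
  finally show ?thesis .
qed

lemma perp_proj_in_perp: "v \<noteq> 0 \<Longrightarrow> perp_proj v w \<in> perp (v::'k::hermitian_scalar^'n)"
  by (simp add: perp_def perp_proj_def herm_diff_left herm_scale_left)

lemma perp_proj_perp: "w \<in> perp v \<Longrightarrow> perp_proj v w = w"
  by (simp add: perp_def perp_proj_def)

lemma perp_proj_add: "perp_proj v (x + y) = perp_proj v x + perp_proj v (y::'k::hermitian_scalar^'n)"
  by (simp add: perp_proj_def herm_add_left add_divide_distrib vec.scale_left_distrib)

lemma perp_proj_scale: "perp_proj v (c *s x) = c *s perp_proj v (x::'k::hermitian_scalar^'n)"
  by (simp add: perp_proj_def herm_scale_left vec.scale_right_diff_distrib)

lemma perp_proj_self [simp]: "perp_proj v (v::'k::hermitian_scalar^'n) = 0"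
  by (cases "v = 0") (simp_all add: perp_proj_def)

lemma norm_perp_proj:
  fixes v w :: "'k::hermitian_scalar^'n"
  assumes "v \<noteq> 0"
  shows "(norm w)\<^sup>2 = (norm (perp_proj v w))\<^sup>2 + (norm (herm w v) / norm v)\<^sup>2"
proof -
  let ?c = "herm w v / herm v v"
  have "herm (perp_proj v w) (?c *s v) = 0"
    using perp_proj_in_perp[OF assms, of w] by (simp add: herm_scale_right perp_def)
  from herm_Pythagoras[OF this]
  have "(norm w)\<^sup>2 = (norm (perp_proj v w))\<^sup>2 + (norm (?c *s v))\<^sup>2"
    by (simp add: perp_proj_def)
  moreover have "norm (?c *s v) = norm (herm w v) / norm v"
    using assms
    by (simp add: norm_vector_smult herm_same norm_divide power2_eq_square del: of_real_mult)
  ultimately show ?thesis by simp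
qed

lemma norm_perp_proj_le:
  fixes v w :: "'k::hermitian_scalar^'n"
  assumes "v \<noteq> 0"
  shows "norm (perp_proj v w) \<le> norm w"
  by (rule power2_le_imp_le) (simp_all add: norm_perp_proj[OF assms, of w])

section \<open>Angles\<close>

text \<open>
  A weak form of Jordan's inequality, whose factor would be \<open>\<pi> / 2\<close>: on this interval the cubic
  term of the Taylor expansion takes away at most half of \<open>x\<close>. The factor \<open>2\<close> is harmless, as it
  only multiplies distances after a Newton step, which are of second order.
\<close>

lemma le_two_sin:
  fixes x :: real
  assumes "0 \<le> x" "x \<le> pi / 2"
  shows "x \<le> 2 * sin x"
proof -
  have "\<bar>sin x - x\<bar> \<le> x ^ 3 / 6"
    using Maclaurin_sin_bound[of x 3] assms
    by (simp add: numeral_3_eq_3 sin_coeff_def divide_simps)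
  moreover have "x ^ 3 \<le> 3 * x"
  proof -
    have "x \<le> 1.6" using assms pi_approx by simp
    then have "x * x \<le> 3"
      using mult_mono[of x "1.6" x "1.6"] assms by simp
    then show ?thesis
      using mult_right_mono[of "x * x" 3 x] assms by (simp add: power3_eq_cube)
  qed
  ultimately show ?thesis by linarith
qed

lemma arccos_between_sines:
  fixes C :: real
  assumes "0 \<le> C" "C \<le> 1"
  shows "sqrt (1 - C\<^sup>2) \<le> arccos C" and "arccos C \<le> 2 * sqrt (1 - C\<^sup>2)"
proof -
  have s: "sin (arccos C) = sqrt (1 - C\<^sup>2)"
    using assms by (intro sin_arccos) auto
  have r: "0 \<le> arccos C" "arccos C \<le> pi / 2"
    using assms arccos_lbound arccos_le_pi2 by auto
  show "sqrt (1 - C\<^sup>2) \<le> arccos C"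
    using sin_x_le_x[OF r(1)] s by simp
  show "arccos C \<le> 2 * sqrt (1 - C\<^sup>2)"
    using le_two_sin[OF r] s by simp
qed

text \<open>
  The sine of the projective distance. Unlike the distance itself it has algebraic expressions
  (lemmas \<open>proj_sin_herm\<close> and \<open>proj_sin_herm_pair\<close>), so all the estimates are made for sines.
\<close>

definition proj_sin ::
  "('a::real_normed_vector \<Rightarrow> 'a \<Rightarrow> 'k::real_normed_field) \<Rightarrow> 'a \<Rightarrow> 'a \<Rightarrow> real" where
  "proj_sin h x y = sqrt (1 - (norm (h x y) / (norm x * norm y))\<^sup>2)"

lemma proj_dist_between_sines:
  assumes "norm (h x y) \<le> norm x * norm y"
  shows "proj_sin h x y \<le> proj_dist h x y" and "proj_dist h x y \<le> 2 * proj_sin h x y"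
    and "0 \<le> proj_dist h x y" and "0 \<le> proj_sin h x y"
proof -
  let ?C = "norm (h x y) / (norm x * norm y)"
  have C: "0 \<le> ?C" "?C \<le> 1"
    using assms by (auto simp: divide_le_eq_1 zero_less_mult_iff)
  show "proj_sin h x y \<le> proj_dist h x y" and "proj_dist h x y \<le> 2 * proj_sin h x y"
    unfolding proj_sin_def proj_dist_def by (rule arccos_between_sines[OF C])+
  show "0 \<le> proj_dist h x y"
    unfolding proj_dist_def by (rule arccos_lbound[OF order_trans[OF _ C(1)] C(2)]) simp
  show "0 \<le> proj_sin h x y"
    unfolding proj_sin_def using power_le_one[OF C, of 2] by simp
qed

lemma proj_sin_herm:
  fixes x y :: "'k::hermitian_scalar^'n"
  assumes "x \<noteq> 0" "y \<noteq> 0"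
  shows "norm y * proj_sin herm x y = norm (perp_proj x y)"
proof -
  have "(norm y * proj_sin herm x y)\<^sup>2 = (norm y)\<^sup>2 * (1 - (norm (herm x y) / (norm x * norm y))\<^sup>2)"
    using proj_dist_between_sines(4)[of herm x y] herm_Cauchy_Schwarz[of x y]
    by (simp add: power_mult_distrib proj_sin_def)
  also have "\<dots> = (norm y)\<^sup>2 - (norm (herm y x) / norm x)\<^sup>2"
    using assms by (simp add: field_simps norm_herm_commute[of x y])
  also have "\<dots> = (norm (perp_proj x y))\<^sup>2"
    using norm_perp_proj[OF assms(1), of y] by simp
  finally show ?thesis
    using proj_dist_between_sines(4)[of herm x y] herm_Cauchy_Schwarz[of x y]
    by (simp add: power2_eq_iff_nonneg)
qed

lemma frob_same: "frob A A = of_real ((norm (A::'k::hermitian_scalar^'n^'n))\<^sup>2)"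
proof -
  have "frob A A = (\<Sum>i\<in>UNIV. herm (A $ i) (A $ i))"
    by (simp add: frob_eq_sum herm_def)
  then show ?thesis
    by (simp add: herm_same norm_vec_def[of A] L2_set_def sum_nonneg del: of_real_power)
qed

text \<open>
  Two pairs with the same matrix lie in the plane spanned by \<open>(A, 0)\<close> and \<open>(0, 1)\<close>, where the
  defect in the Cauchy-Schwarz inequality is a single squared determinant (Lagrange's identity).
\<close>

lemma herm_pair_Lagrange:
  fixes A :: "'k::hermitian_scalar^'n^'n"
  shows "(norm (A, l))\<^sup>2 * (norm (A, l'))\<^sup>2 - (norm (herm_pair (A, l) (A, l')))\<^sup>2
    = (norm A * norm (l - l'))\<^sup>2"
proof -
  define a :: 'k where "a = of_real ((norm A)\<^sup>2)"
  have a: "conjugate a = a" by (simp add: a_def del: of_real_power)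
  have n: "(of_real ((norm (A, t))\<^sup>2) :: 'k) = a + t * conjugate t" for t
    by (simp add: norm_prod_def a_def mult_conjugate_self)
  have h: "herm_pair (A, l) (A, l') = a + l * conjugate l'"
    by (simp add: herm_pair_def frob_same a_def)
  have "(of_real ((norm (A, l))\<^sup>2 * (norm (A, l'))\<^sup>2 - (norm (herm_pair (A, l) (A, l')))\<^sup>2) :: 'k)
     = (a + l * conjugate l) * (a + l' * conjugate l')
       - (a + l * conjugate l') * (a + conjugate l * l')"
    unfolding of_real_diff of_real_mult n mult_conjugate_self[symmetric] h
    by (simp add: conjugate_dist_add conjugate_dist_mul a)
  also have "\<dots> = a * ((l - l') * conjugate (l - l'))"
    unfolding conjugate_diff by (simp add: algebra_simps)
  also have "\<dots> = of_real ((norm A * norm (l - l'))\<^sup>2)"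
    unfolding mult_conjugate_self a_def by (simp add: power_mult_distrib)
  finally show ?thesis by (simp only: of_real_eq_iff)
qed

lemma herm_pair_Cauchy_Schwarz:
  fixes A :: "'k::hermitian_scalar^'n^'n"
  shows "norm (herm_pair (A, l) (A, l')) \<le> norm (A, l) * norm (A, l')"
proof (rule power2_le_imp_le)
  show "(norm (herm_pair (A, l) (A, l')))\<^sup>2 \<le> (norm (A, l) * norm (A, l'))\<^sup>2"
    using herm_pair_Lagrange[of A l l'] zero_le_power2[of "norm A * norm (l - l')"]
    unfolding power_mult_distrib by linarith
qed simp

lemma proj_sin_herm_pair:
  fixes A :: "'k::hermitian_scalar^'n^'n"
  assumes "A \<noteq> 0"
  shows "norm (A, l) * norm (A, l') * proj_sin herm_pair (A, l) (A, l') = norm A * norm (l - l')"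
proof -
  let ?R = "norm (A, l)" and ?R' = "norm (A, l')" and ?s = "proj_sin herm_pair (A, l) (A, l')"
  have s0: "0 \<le> ?s" and R: "?R \<noteq> 0" "?R' \<noteq> 0"
    using proj_dist_between_sines(4)[of herm_pair "(A, l)" "(A, l')"] herm_pair_Cauchy_Schwarz[of A l l'] assms
    by (auto simp: zero_prod_def)
  have "(?R * ?R' * ?s)\<^sup>2
      = (?R * ?R')\<^sup>2 * (1 - (norm (herm_pair (A, l) (A, l')) / (?R * ?R'))\<^sup>2)"
    using s0 by (simp add: power_mult_distrib proj_sin_def)
  also have "\<dots> = ?R\<^sup>2 * ?R'\<^sup>2 - (norm (herm_pair (A, l) (A, l')))\<^sup>2"
    using R by (simp add: field_simps)
  also have "\<dots> = (norm A * norm (l - l'))\<^sup>2"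
    by (rule herm_pair_Lagrange)
  finally show ?thesis
    using s0 by (simp add: power2_eq_iff_nonneg)
qed

section \<open>Simple eigenvalues\<close>

lemma poly_det:
  "poly (det M) x = det (\<chi> i j. poly (M $ i $ j) (x::'k::comm_ring_1))"
  by (simp add: det_def poly_sum poly_prod)

lemma poly_charpoly: "poly (charpoly A) x = det (mat x - (A::'k::field^'n^'n))"
proof -
  have "(\<chi> i j. poly ((mat [:0, 1:] - map_matrix (\<lambda>a. [:a:]) A) $ i $ j) x) = mat x - A"
    by (simp add: vec_eq_iff map_matrix_def mat_def)
  then show ?thesis by (simp add: charpoly_def poly_det)
qed

text \<open>
  Needed because the order of a root is unspecified for the zero polynomial. A scalar of modulus
  greater than the norm of \<open>A\<close> is no eigenvalue, hence no root.
\<close>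

lemma charpoly_neq_0: "charpoly (A :: 'k::hermitian_scalar^'n^'n) \<noteq> 0"
proof -
  let ?x = "of_real (norm A + 1) :: 'k"
  have "z = 0" if "(mat ?x - A) *v z = 0" for z
  proof -
    have "norm (?x *s z) \<le> norm A * norm z"
      using that norm_matrix_vector_mult_le[of A z] by (simp add: mat_diff_mult_vec)
    then have "(norm A + 1) * norm z \<le> norm A * norm z"
      by (simp add: norm_vector_smult del: of_real_add)
    then show ?thesis by (simp add: distrib_right)
  qed
  then have "invertible (mat ?x - A)"
    by (simp add: invertible_left_inverse matrix_left_invertible_ker)
  then have "poly (charpoly A) ?x \<noteq> 0"
    unfolding poly_charpoly by (simp add: invertible_det_nz)
  then show ?thesis by auto
qed

text \<open>
  Subtracting \<open>c\<close> times row \<open>i\<close>, once it has been divided by \<open>p\<close>, from row \<open>j\<close> makes that row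
  divisible by \<open>p\<close> as well.
\<close>

lemma det_two_scaled_rows:
  fixes R :: "'a::comm_ring_1^'n^'n"
  assumes "i \<noteq> j" and "R $ i = p *s x" and "R $ j = p *s y + c *s x"
  shows "p\<^sup>2 dvd det R"
proof -
  define S :: "'a^'n^'n" where "S = (\<chi> k. if k = i then x else R $ k)"
  have "R = (\<chi> k. if k = i then p *s x else R $ k)"
    by (simp add: vec_eq_iff assms(2))
  then have 1: "det R = p * det S"
    using det_row_mul[of i p "\<lambda>_. x" "\<lambda>k. R $ k"] by (simp add: S_def)
  have "(\<chi> k. if k = j then row j S + (- c) *s row i S else row k S)
    = (\<chi> k. if k = j then p *s y else S $ k)"
    using assms(1,3) by (auto simp: vec_eq_iff S_def row_def)
  then have 2: "det S = p * det (\<chi> k. if k = j then y else S $ k)"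
    using det_row_operation[of j i S "- c"] assms(1) det_row_mul[of j p "\<lambda>_. y" "\<lambda>k. S $ k"]
    by simp
  show ?thesis unfolding 1 2 power2_eq_square by (simp add: mult.assoc[symmetric])
qed

text \<open>
  If \<open>v\<close> and \<open>w\<close> were independent, they would span an invariant plane on which \<open>A\<close> has the
  double eigenvalue \<open>l\<close>. To see the double root in the characteristic polynomial, multiply
  \<open>X - A\<close> by an invertible constant matrix \<open>P\<close> having \<open>v\<close> and (a modification of) \<open>w\<close> among its
  columns: the product has the two columns \<open>(X - l) v\<close> and \<open>(X - l) w + c v\<close>, hence a
  determinant divisible by \<open>(X - l)\<^sup>2\<close>. The matrix \<open>P\<close> is the identity with two columns
  replaced, at positions where a pivot of \<open>v\<close> and one of \<open>w\<close> make it invertible.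
\<close>

lemma simple_eigenvalue_no_generalized_eigenvector:
  fixes A :: "'k::hermitian_scalar^'n^'n"
  assumes simple: "simple_eigenvalue A l" and v: "v \<noteq> 0" "A *v v = l *s v"
    and w: "A *v w = l *s w - c *s v"
  shows "\<exists>a. w = a *s v"
proof (rule ccontr)
  assume nex: "\<nexists>a. w = a *s v"
  obtain i where i: "v $ i \<noteq> 0" using v(1) by (auto simp: vec_eq_iff)
  (* Clearing entry i of w with the pivot of v leaves the relation with A unchanged, and
     forces any other pivot j of the result to differ from i. *)
  define w' where "w' = w - (w $ i / v $ i) *s v"
  have w'i: "w' $ i = 0" using i by (simp add: w'_def)
  have "w' \<noteq> 0" using nex by (auto simp: w'_def)
  then obtain j where j: "w' $ j \<noteq> 0" by (auto simp: vec_eq_iff)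
  have ij: "i \<noteq> j" using j w'i by auto
  have Aw': "A *v w' = l *s w' - c *s v"
    using w v(2) by (simp add: w'_def matrix_vector_mult_diff_distrib vec.scale_right_diff_distrib
      matrix_vector_mult_scaleR vec.scale_left_commute vec.linear_scale[OF matrix_vector_mul_linear_gen])
  define P :: "'k^'n^'n" where
    "P = (\<chi> r k. if k = i then v $ r else if k = j then w' $ r else if r = k then 1 else 0)"
  have Px: "(P *v x) $ r
      = v $ r * x $ i + w' $ r * x $ j + (if r = i \<or> r = j then 0 else x $ r)" for x r
  proof -
    have "(P *v x) $ r = (\<Sum>k\<in>UNIV. (if k = i then v $ r * x $ i else 0)
        + ((if k = j then w' $ r * x $ j else 0)
        + (if k = r then (if r = i \<or> r = j then 0 else x $ r) else 0)))"
      unfolding matrix_vector_mult_def vec_lambda_beta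
      by (rule sum.cong) (use ij in \<open>auto simp: P_def\<close>)
    then show ?thesis by (simp add: sum.distrib)
  qed
  have "x = 0" if "P *v x = 0" for x
  proof -
    have xi: "x $ i = 0" using Px[of x i] that i w'i by simp
    have xj: "x $ j = 0" using Px[of x j] that j xi by simp
    show ?thesis
    proof (subst vec_eq_iff, intro allI)
      fix r show "x $ r = 0 $ r" using Px[of x r] that xi xj by (cases "r = i \<or> r = j") auto
    qed
  qed
  then have detP: "det P \<noteq> 0"
    by (metis invertible_left_inverse matrix_left_invertible_ker invertible_det_nz)
  let ?C = "map_matrix (\<lambda>a. [:a:]) :: 'k^'n^'n \<Rightarrow> 'k poly^'n^'n"
  let ?V = "\<lambda>x :: 'k^'n. \<chi> k. [:x $ k:]"
  let ?X = "mat [:0, 1:] - ?C A" and ?p = "[:- l, 1:]"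
  define R where "R = transpose (?X ** ?C P)"
  have sum_const: "(\<Sum>k\<in>S. [:f k:]) = [:\<Sum>k\<in>S. f k:]" for f :: "'n \<Rightarrow> 'k" and S
    by (induction S rule: infinite_finite_induct) auto
  have XV: "?X *v ?V x = [:0, 1:] *s ?V x - ?V (A *v x)" for x
    unfolding mat_diff_mult_vec
    by (simp add: vec_eq_iff matrix_vector_mult_def map_matrix_def sum_const mult.commute)
  have R: "R $ k = ?X *v column k (?C P)" for k
    by (simp add: R_def vec_eq_iff transpose_def matrix_matrix_mult_def matrix_vector_mult_def column_def)
  have "column i (?C P) = ?V v" "column j (?C P) = ?V w'"
    using ij by (simp_all add: vec_eq_iff column_def map_matrix_def P_def)
  then have "R $ i = [:0, 1:] *s ?V v - ?V (l *s v)"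
    "R $ j = [:0, 1:] *s ?V w' - ?V (l *s w' - c *s v)"
    unfolding R v(2)[symmetric] Aw'[symmetric] by (simp_all only: XV)
  then have "R $ i = ?p *s ?V v" "R $ j = ?p *s ?V w' + [:c:] *s ?V v"
    by (simp_all add: vec_eq_iff algebra_simps)
  from det_two_scaled_rows[OF ij this]
  have dvd: "?p\<^sup>2 dvd charpoly A * det (?C P)"
    by (simp add: R_def det_transpose det_mul charpoly_def)
  have "poly (det (?C P)) l = det P"
    by (simp add: poly_det map_matrix_def)
  with detP have nz: "poly (det (?C P)) l \<noteq> 0" by simp
  then have nz': "det (?C P) \<noteq> 0" by auto
  have "order l (charpoly A * det (?C P)) = 1"
    using simple nz nz' charpoly_neq_0[of A] order_0I[OF nz]
    by (simp add: order_mult simple_eigenvalue_def)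
  with dvd nz' charpoly_neq_0[of A] show False
    by (simp add: order_divides)
qed

section \<open>The condition number\<close>

lemma linear_perp_proj: "linear (perp_proj (v::'k::hermitian_scalar^'n))"
  by (rule linearI) (simp_all add: perp_proj_add perp_proj_scale scaleR_vec_eq)

lemma linear_mult_vec: "linear (\<lambda>x. B *v (x::'k::hermitian_scalar^'n))"
  by (rule linearI) (simp_all add: matrix_vector_right_distrib scaleR_vec_eq
    vec.linear_scale[OF matrix_vector_mul_linear_gen])

lemma linear_cond_op: "linear (cond_op A l (v::'k::hermitian_scalar^'n))"
  unfolding cond_op_def
  using linear_compose[OF linear_mult_vec linear_perp_proj] by (simp add: o_def)

lemma perp_proj_decomp: "w = perp_proj v w + (herm w v / herm v v) *s v"
  by (simp add: perp_proj_def)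

lemma cond_op_eq_0:
  fixes A :: "'k::hermitian_scalar^'n^'n"
  assumes wp: "(A, l, v) \<in> well_posed" and w: "w \<in> perp v" and 0: "cond_op A l v w = 0"
  shows "w = 0"
proof -
  have v: "v \<noteq> 0" "A *v v = l *s v" and s: "simple_eigenvalue A l"
    using wp by (auto simp: well_posed_def solution_variety_def mat_diff_mult_vec)
  define c where "c = herm ((mat l - A) *v w) v / herm v v"
  have "(mat l - A) *v w = c *s v"
    using perp_proj_decomp[of "(mat l - A) *v w" v] 0 by (simp add: cond_op_def c_def)
  then have "A *v w = l *s w - c *s v" unfolding mat_diff_mult_vec by (simp add: algebra_simps)
  from simple_eigenvalue_no_generalized_eigenvector[OF s v this]
  obtain a where a: "w = a *s v" by blast
  then have "a * herm v v = 0" using w by (simp add: perp_def herm_scale_left)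
  then show "w = 0" using v a by simp
qed

text \<open>
  The operator \<open>cond_op A l v\<close> only matters on \<open>perp v\<close>. It is extended by the identity on the line
  of \<open>v\<close> to an endomorphism \<open>T\<close> of the whole space, to which the theorems on injective linear maps
  of Euclidean spaces apply.
\<close>

lemma cond_op_bij:
  fixes A :: "'k::hermitian_scalar^'n^'n"
  assumes wp: "(A, l, v) \<in> well_posed"
  shows "bij_betw (cond_op A l v) (perp v) (perp v)"
    and "\<exists>B>0. \<forall>w\<in>perp v. B * norm w \<le> norm (cond_op A l v w)"
proof -
  let ?M = "cond_op A l v"
  have v: "v \<noteq> 0"
    using wp by (auto simp: well_posed_def solution_variety_def)
  define T where "T x = ?M (perp_proj v x) + (x - perp_proj v x)" for x
  have linT: "linear T"
    unfolding T_def
    by (intro linear_compose_add linear_compose_sub linear_ident linear_perp_proj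
      linear_compose[OF linear_perp_proj linear_cond_op, unfolded o_def])
  have pp: "perp_proj v (perp_proj v x) = perp_proj v x" for x
    using perp_proj_in_perp[OF v] by (simp add: perp_proj_perp)
  have pM: "perp_proj v (?M x) = ?M x" for x
    by (simp add: cond_op_def pp)
  have pT: "perp_proj v (T x) = ?M (perp_proj v x)" for x
    by (simp add: T_def perp_proj_add pM pp linear_diff[OF linear_perp_proj])
  have T_perp: "T x = ?M x" if "x \<in> perp v" for x
    using that by (simp add: T_def perp_proj_perp)
  have injT: "inj T"
  proof (subst linear_injective_0[OF linT], intro allI impI)
    fix x assume 0: "T x = 0"
    then have "?M (perp_proj v x) = 0" using pT[of x] by (simp add: linear_0[OF linear_perp_proj])
    then have "perp_proj v x = 0"
      using cond_op_eq_0[OF wp] perp_proj_in_perp[OF v] by blast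
    with 0 show "x = 0" by (simp add: T_def linear_0[OF linear_cond_op])
  qed
  have surjT: "surj T" using linear_injective_imp_surjective[OF linT injT] by simp
  show "bij_betw ?M (perp v) (perp v)"
  proof (rule bij_betw_imageI)
    show "inj_on ?M (perp v)"
    proof (rule inj_onI)
      fix x y assume "x \<in> perp v" "y \<in> perp v" "?M x = ?M y"
      then have "T x = T y" by (simp only: T_perp)
      then show "x = y" by (rule injD[OF injT])
    qed
    have "y \<in> ?M ` perp v" if y: "y \<in> perp v" for y
    proof -
      obtain x where "y = T x" using surjT by blast
      then have "y = ?M (perp_proj v x)" using pT[of x] y by (simp add: perp_proj_perp)
      then show ?thesis using perp_proj_in_perp[OF v] by blast
    qed
    moreover have "?M x \<in> perp v" for x
      using perp_proj_in_perp[OF v] by (simp add: cond_op_def)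
    ultimately show "?M ` perp v = perp v" by blast
  qed
  obtain B where B: "B > 0" "\<And>x. B * norm x \<le> norm (T x)"
    using linear_inj_bounded_below_pos[OF linT injT] by blast
  have "B * norm w \<le> norm (?M w)" if "w \<in> perp v" for w
    using B(2)[of w] by (simp only: T_perp[OF that])
  with B(1) show "\<exists>B>0. \<forall>w\<in>perp v. B * norm w \<le> norm (?M w)"
    by blast
qed

text \<open>
  The form in which the condition number enters the analysis: a lower bound for
  \<open>cond_op A l v\<close> instead of an upper bound for its inverse. The supremum defining the norm of the
  inverse is finite because the operator is bounded below.
\<close>

lemma norm_le_cond_number:
  fixes A :: "'k::hermitian_scalar^'n^'n"
  assumes wp: "(A, l, v) \<in> well_posed" and w: "w \<in> perp v"
  shows "norm A * norm w \<le> cond_number (A, l, v) * norm (cond_op A l v w)"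
proof -
  let ?M = "cond_op A l v" and ?I = "inv_into (perp v) (cond_op A l v)"
  note bij = cond_op_bij(1)[OF wp]
  obtain B where B: "B > 0" "\<forall>w\<in>perp v. B * norm w \<le> norm (?M w)"
    using cond_op_bij(2)[OF wp] by blast
  have bdd: "bdd_above ((\<lambda>x. norm (?I x) / norm x) ` perp v)"
  proof (rule bdd_aboveI2)
    fix x assume x: "x \<in> perp v"
    then have Ix: "?I x \<in> perp v" "?M (?I x) = x"
      using bij by (simp_all add: bij_betw_def inv_into_into f_inv_into_f)
    show "norm (?I x) / norm x \<le> 1 / B"
      using B(1) B(2)[rule_format, OF Ix(1)] unfolding Ix(2)
      by (cases "x = 0") (simp_all add: field_simps)
  qed
  let ?m = "onorm_on (perp v) ?I"
  have Mw: "?M w \<in> perp v" "?I (?M w) = w"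
    using bij w by (auto simp: bij_betw_def)
  have "norm (?I (?M w)) / norm (?M w) \<le> ?m"
    unfolding onorm_on_def by (rule cSUP_upper[OF Mw(1) bdd])
  moreover have "w = 0" if "?M w = 0" using cond_op_eq_0[OF wp w that] .
  ultimately have "norm w \<le> ?m * norm (?M w)"
    unfolding Mw(2) by (cases "?M w = 0") (auto simp: field_simps)
  then have "norm A * norm w \<le> (norm A * ?m) * norm (?M w)"
    by (simp add: mult.assoc mult_left_mono)
  also have "\<dots> \<le> cond_number (A, l, v) * norm (?M w)"
    by (intro mult_right_mono) (simp_all add: cond_number_def)
  finally show ?thesis .
qed

section \<open>One Newton step\<close>

lemma eigenvalue_norm_le:
  fixes A :: "'k::hermitian_scalar^'n^'n"
  assumes "A *v v = l *s v" "v \<noteq> 0"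
  shows "norm l \<le> norm A"
  using norm_matrix_vector_mult_le[of A v] assms by (simp add: norm_vector_smult)

text \<open>
  The perturbation \<open>d\<close> of the eigenvalue in terms of the angle \<open>a\<close> between \<open>(A, l0)\<close> and \<open>(A, l)\<close>,
  with \<open>N\<close> the norm of \<open>A\<close> and \<open>R\<close>, \<open>R0\<close> the norms of the pairs. As an eigenvalue is at most
  \<open>N\<close> in modulus, \<open>R \<le> sqrt 2 * N\<close>, so to first order \<open>d \<le> 2 * N * a\<close>; the bound on \<open>a\<close> controls the
  quadratic term.
\<close>

lemma shift_from_angle:
  fixes N a :: real
  assumes N: "N > 0" and R: "R * R0 * sa = N * d" "0 \<le> R" "R0 \<le> R + d" "R \<le> sqrt 2 * N"
    and d: "0 \<le> d" and sa: "0 \<le> sa" "sa \<le> a" "a \<le> 0.0739"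
  shows "d \<le> 2.24 * N * a"
proof -
  let ?r = "sqrt 2 * N"
  have s2: "sqrt 2 \<le> 1.4143" by (rule real_le_lsqrt) (simp_all add: power2_eq_square)
  have "N * d \<le> R * (R + d) * sa"
    unfolding R(1)[symmetric] using R sa by (intro mult_right_mono mult_left_mono) auto
  also have "\<dots> \<le> ?r * (?r + d) * sa"
    using R d sa N by (intro mult_right_mono mult_mono add_mono) auto
  also have "\<dots> = N * (2 * N * sa + sqrt 2 * sa * d)"
    by (simp add: algebra_simps)
  finally have "d \<le> 2 * N * sa + sqrt 2 * sa * d" using N by simp
  also have "\<dots> \<le> 2 * N * a + 0.10452 * d"
  proof (intro add_mono mult_right_mono)
    show "2 * N * sa \<le> 2 * N * a" using N sa by simp
    have "sqrt 2 * sa \<le> 1.4143 * 0.0739" using s2 sa by (intro mult_mono) auto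
    then show "sqrt 2 * sa \<le> 0.10452" by simp
  qed (use d in auto)
  finally have "0.89548 * d \<le> 2 * (N * a)" by simp
  moreover have "0 \<le> N * a" using N sa by simp
  ultimately show ?thesis by (simp add: mult.assoc)
qed

text \<open>
  A right triangle with hypotenuse \<open>k\<close>, legs \<open>u\<close> and \<open>r\<close>, and an angle with sine \<open>s\<close> opposite to
  \<open>u\<close>: for small angles the tangent \<open>u / r\<close> hardly exceeds the angle.
\<close>

lemma tangent_from_angle:
  fixes r s b u k :: real
  assumes r: "0 < r" and uk: "u = k * s" "k\<^sup>2 = r\<^sup>2 + u\<^sup>2"
    and s: "0 \<le> s" "s \<le> b" "b \<le> 0.0739"
  shows "u \<le> 1.01 * b * r"
proof -
  have "s * s \<le> 0.0739 * 0.0739" using s by (intro mult_mono) auto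
  then have s2: "s\<^sup>2 \<le> 0.01" by (simp add: power2_eq_square)
  have "u\<^sup>2 = k\<^sup>2 * s\<^sup>2" unfolding uk(1) by (rule power_mult_distrib)
  also have "\<dots> \<le> k\<^sup>2 * 0.01" using s2 by (intro mult_left_mono) auto
  finally have "k\<^sup>2 * 0.99 \<le> r\<^sup>2" using uk(2) by simp
  moreover have "K * 0.99 \<le> R \<Longrightarrow> 0 \<le> R \<Longrightarrow> K \<le> 1.0201 * R" for K R :: real by simp
  ultimately have "k\<^sup>2 \<le> 1.0201 * r\<^sup>2" using zero_le_power2[of r] by blast
  also have "\<dots> = (1.01 * r)\<^sup>2" by (simp add: power2_eq_square)
  finally have "k \<le> 1.01 * r" by (rule power2_le_imp_le) (use r in simp)
  then have "k * s \<le> 1.01 * r * b" using s r by (intro mult_mono) auto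
  then show ?thesis by (simp add: uk(1) mult_ac)
qed

lemma norm_le_add_perp:
  fixes v0 u :: "'k::hermitian_scalar^'n"
  assumes "herm u v0 = 0"
  shows "norm v0 \<le> norm (v0 + u)"
proof (rule power2_le_imp_le)
  show "(norm v0)\<^sup>2 \<le> (norm (v0 + u))\<^sup>2"
    unfolding add.commute[of v0 u] herm_Pythagoras[OF assms] by simp
qed simp

text \<open>
  Take the product of the equation with \<open>v0\<close>: the terms \<open>l0 e\<close> and \<open>y\<close> disappear, so that only
  the entry \<open>herm (A *v e) v0\<close> of \<open>A\<close> balances \<open>s\<close>.
\<close>

lemma norm_radial_part_le:
  fixes A :: "'k::hermitian_scalar^'n^'n"
  assumes v0: "v0 \<noteq> 0" and e: "herm e v0 = 0" and y: "herm y v0 = 0"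
    and eq: "(mat l0 - A) *v e = y + s *s v0"
  shows "norm s * norm v0 \<le> norm A * norm e"
proof -
  have "A *v e = l0 *s e - y - s *s v0"
    using eq unfolding mat_diff_mult_vec by (simp add: algebra_simps)
  then have "herm (A *v e) v0 = - (s * herm v0 v0)"
    by (simp add: herm_diff_left herm_scale_left e y)
  then have "norm s * (norm v0)\<^sup>2 = norm (herm (A *v e) v0)"
    by (simp add: herm_same norm_mult norm_power)
  also have "\<dots> \<le> norm A * norm e * norm v0"
    by (intro order_trans[OF herm_Cauchy_Schwarz] mult_right_mono norm_matrix_vector_mult_le) simp
  finally show ?thesis
    using v0 by (simp add: power2_eq_square mult.assoc[symmetric])
qed

text \<open>
  Invertibility of the projected operator survives a small change of \<open>(l, v)\<close> to \<open>(l0, v0)\<close>.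
  Let \<open>w\<close> be the projection of \<open>e\<close> onto \<open>perp v\<close>. Since \<open>v\<close> is an eigenvector, \<open>mat l - A\<close> takes
  the same value at \<open>w\<close> and at \<open>e\<close>, and since \<open>v0 + u\<close> is a multiple of \<open>v\<close>, projecting that value
  onto \<open>perp v\<close> replaces \<open>s v0\<close> by the small vector \<open>- s u\<close>. Therefore \<open>cond_op A l v w\<close> differs
  from the projection of \<open>y\<close> only by terms that \<open>l0 - l\<close> and \<open>u\<close> make small, and
  \<open>norm_le_cond_number\<close> bounds \<open>w\<close>; finally \<open>e\<close> and \<open>w\<close> differ by at most \<open>norm u / norm v0\<close>
  times \<open>norm e\<close>. Together the errors are at most the fraction \<open>0.32\<close> of \<open>norm e\<close>.
\<close>

lemma inverse_bound_near_eigenvector: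
  fixes A :: "'k::hermitian_scalar^'n^'n"
  assumes wp: "(A, l, v) \<in> well_posed" and A: "A \<noteq> 0"
    and v0: "v0 \<noteq> 0" and u: "v0 + u = \<kappa> *s v" "herm u v0 = 0"
    and close: "cond_number (A, l, v) * (norm (l0 - l) / norm A + norm u / norm v0)
        + norm u / norm v0 \<le> 0.32"
    and e: "herm e v0 = 0" and y: "herm y v0 = 0" and eq: "(mat l0 - A) *v e = y + s *s v0"
  shows "0.68 * norm A * norm e \<le> cond_number (A, l, v) * norm y"
proof -
  define t where "t = norm u / norm v0"
  let ?\<mu> = "cond_number (A, l, v)"
  have v: "v \<noteq> 0" and Av: "(mat l - A) *v v = 0"
    using wp by (auto simp: well_posed_def solution_variety_def)
  have N: "norm A > 0" and r: "norm v0 > 0" using A v0 by auto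
  have \<mu>: "0 \<le> ?\<mu>" by (simp add: cond_number_def)
  have t: "0 \<le> t" "norm u = t * norm v0" using r by (simp_all add: t_def)
  define w c where "w = perp_proj v e" and "c = herm e v / herm v v"
  have w: "w \<in> perp v" unfolding w_def by (rule perp_proj_in_perp[OF v])
  have ew: "e = w + c *s v" unfolding w_def c_def by (rule perp_proj_decomp)
  have "(mat l - A) *v w = (mat l - A) *v e"
    unfolding ew by (simp add: matrix_vector_right_distrib vec.scale[symmetric] Av
      vec.linear_scale[OF matrix_vector_mul_linear_gen])
  also have "\<dots> = y + s *s v0 - (l0 - l) *s e"
    using eq unfolding mat_diff_mult_vec by (simp add: algebra_simps)
  also have "\<dots> = (y - s *s u - (l0 - l) *s e) + (s * \<kappa>) *s v"
  proof -
    have "(s * \<kappa>) *s v = s *s (v0 + u)" by (simp add: u(1))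
    then show ?thesis by (simp add: vec.scale_right_distrib)
  qed
  finally have Mw: "cond_op A l v w = perp_proj v (y - s *s u - (l0 - l) *s e)"
    by (simp add: cond_op_def perp_proj_add perp_proj_scale)
  have "norm (cond_op A l v w) \<le> norm (y - s *s u - (l0 - l) *s e)"
    unfolding Mw by (rule norm_perp_proj_le[OF v])
  also have "\<dots> \<le> norm y + norm (s *s u) + norm ((l0 - l) *s e)"
    by (intro order_trans[OF norm_triangle_ineq4] add_mono norm_triangle_ineq4 order_refl)
  also have "norm (s *s u) = t * (norm s * norm v0)"
    by (simp add: norm_vector_smult t(2) mult_ac)
  also have "\<dots> \<le> t * (norm A * norm e)"
    by (intro mult_left_mono t(1) norm_radial_part_le[OF v0 e y eq])
  also have "norm ((l0 - l) *s e) = norm (l0 - l) * norm e"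
    by (rule norm_vector_smult)
  finally have M: "norm (cond_op A l v w) \<le> norm y + t * (norm A * norm e) + norm (l0 - l) * norm e"
    by simp
  have "norm A * norm w \<le> ?\<mu> * norm (cond_op A l v w)"
    by (rule norm_le_cond_number[OF wp w])
  also have "\<dots> \<le> ?\<mu> * (norm y + t * (norm A * norm e) + norm (l0 - l) * norm e)"
    by (rule mult_left_mono[OF M \<mu>])
  also have "\<dots> = ?\<mu> * norm y + ?\<mu> * (norm (l0 - l) / norm A + t) * (norm A * norm e)"
    using N by (simp add: field_simps)
  finally have Nw: "norm A * norm w
      \<le> ?\<mu> * norm y + ?\<mu> * (norm (l0 - l) / norm A + t) * (norm A * norm e)" .
  have \<kappa>v: "norm v0 \<le> norm \<kappa> * norm v"
    using norm_le_add_perp[OF u(2)] by (simp add: u(1) norm_vector_smult)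
  have "norm v0 * norm (c *s v) \<le> norm \<kappa> * norm v * norm (c *s v)"
    by (rule mult_right_mono[OF \<kappa>v]) simp
  also have "\<dots> = norm \<kappa> * norm (herm e v)"
    using v by (simp add: c_def norm_vector_smult norm_divide herm_same norm_power power2_eq_square norm_mult)
  also have "\<dots> = norm (herm e (\<kappa> *s v))"
    by (simp add: herm_scale_right norm_mult)
  also have "\<dots> = norm (herm e u)"
    by (simp add: u(1)[symmetric] herm_add_right e)
  also have "\<dots> \<le> norm e * norm u" by (rule herm_Cauchy_Schwarz)
  finally have "norm v0 * norm (c *s v) \<le> norm v0 * (t * norm e)" by (simp add: t(2) mult_ac)
  then have cv: "norm (c *s v) \<le> t * norm e" using r by simp
  have "norm e \<le> norm w + t * norm e"
    using norm_triangle_ineq[of w "c *s v"] cv by (simp add: ew[symmetric])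
  then have "norm A * norm e \<le> norm A * norm w + t * (norm A * norm e)"
    using mult_left_mono[of _ _ "norm A"] by (fastforce simp: algebra_simps)
  also have "\<dots> \<le> ?\<mu> * norm y + (?\<mu> * (norm (l0 - l) / norm A + t) + t) * (norm A * norm e)"
    using Nw by (simp add: distrib_right)
  also have "\<dots> \<le> ?\<mu> * norm y + 0.32 * (norm A * norm e)"
    using close by (intro add_left_mono mult_right_mono) (simp_all add: t_def)
  finally show ?thesis by simp
qed

text \<open>
  Writing a vector as a multiple of \<open>v0\<close> plus its projection onto \<open>perp v0\<close> identifies the whole
  space with the domain of the restricted derivative, so bijectivity follows from a trivial
  kernel by linear algebra in a single space.
\<close>

lemma newton_domainI:
  fixes A :: "'k::hermitian_scalar^'n^'n"
  assumes v0: "v0 \<noteq> 0"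
    and ker: "\<And>e c. herm e v0 = 0 \<Longrightarrow> (mat l0 - A) *v e = c *s v0 \<Longrightarrow> e = 0"
  shows "(l0, v0) \<in> newton_domain A"
proof -
  let ?D = "eig_deriv A (l0, v0)"
  define T where "T z = herm z v0 *s v0 + (mat l0 - A) *v perp_proj v0 z" for z
  have linT: "linear T"
    by (rule linearI)
      (simp_all add: T_def herm_add_left herm_scale_left perp_proj_add perp_proj_scale scaleR_vec_eq
        matrix_vector_right_distrib vec.scale_left_distrib vec.scale_right_distrib
        vec.linear_scale[OF matrix_vector_mul_linear_gen])
  have D0: "c = 0 \<and> e = 0" if "herm e v0 = 0" "c *s v0 + (mat l0 - A) *v e = 0" for c e
  proof -
    have "(mat l0 - A) *v e = (- c) *s v0" using that(2) by (simp add: add_eq_0_iff)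
    from ker[OF that(1) this] have "e = 0" .
    with that(2) v0 show ?thesis by simp
  qed
  have "inj T"
  proof (subst linear_injective_0[OF linT], intro allI impI)
    fix z assume "T z = 0"
    then have "herm z v0 = 0 \<and> perp_proj v0 z = 0"
      using perp_proj_in_perp[OF v0, of z] by (intro D0) (simp_all add: T_def perp_def)
    then show "z = 0" using perp_proj_decomp[of z v0] by simp
  qed
  then have surjT: "surj T"
    using linear_injective_imp_surjective[OF linT] by simp
  have "bij_betw ?D (UNIV \<times> perp v0) UNIV"
  proof (rule bij_betw_imageI)
    show "inj_on ?D (UNIV \<times> perp v0)"
    proof (rule inj_onI, clarify)
      fix c c' e e' assume "e \<in> perp v0" "e' \<in> perp v0" and eq: "?D (c, e) = ?D (c', e')"
      have "c - c' = 0 \<and> e - e' = 0"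
      proof (rule D0)
        show "herm (e - e') v0 = 0"
          using \<open>e \<in> perp v0\<close> \<open>e' \<in> perp v0\<close> by (simp add: perp_def herm_diff_left)
        show "(c - c') *s v0 + (mat l0 - A) *v (e - e') = 0"
          using eq by (simp add: eig_deriv_def vec.scale_left_diff_distrib
            matrix_vector_mult_diff_distrib algebra_simps)
      qed
      then show "c = c' \<and> e = e'" by simp
    qed
    have "y \<in> ?D ` (UNIV \<times> perp v0)" for y
    proof -
      obtain z where "y = T z" using surjT by blast
      then have "y = ?D (herm z v0, perp_proj v0 z)" by (simp add: T_def eig_deriv_def)
      then show ?thesis using perp_proj_in_perp[OF v0] by blast
    qed
    then show "?D ` (UNIV \<times> perp v0) = UNIV" by blast
  qed
  with v0 show ?thesis by (simp add: newton_domain_def)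
qed

text \<open>
  The derivative equation, rewritten for the new point: a Newton step is a step of inverse
  iteration, normalised by \<open>v1 - v0 \<in> perp v0\<close>.
\<close>

lemma newton_characterization:
  fixes A :: "'k::hermitian_scalar^'n^'n"
  assumes dom: "(l0, v0) \<in> newton_domain A"
  obtains l1 v1 where "newton A (l0, v0) = (l1, v1)" "herm (v1 - v0) v0 = 0"
    "(mat l0 - A) *v v1 = (l0 - l1) *s v0"
proof -
  let ?D = "eig_deriv A (l0, v0)" and ?S = "UNIV \<times> perp v0"
  have bij: "bij_betw ?D ?S UNIV" using dom by (simp add: newton_domain_def)
  obtain dl dv where d: "inv_into ?S ?D (eig_map A (l0, v0)) = (dl, dv)" by fastforce
  have img: "eig_map A (l0, v0) \<in> ?D ` ?S" using bij by (simp add: bij_betw_def)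
  have perp: "dv \<in> perp v0" using inv_into_into[OF img] by (simp add: d)
  have eq: "dl *s v0 + (mat l0 - A) *v dv = (mat l0 - A) *v v0"
    using f_inv_into_f[OF img] unfolding d by (simp add: eig_deriv_def eig_map_def)
  show thesis
  proof (rule that)
    show "newton A (l0, v0) = (l0 - dl, v0 - dv)" by (simp add: newton_def d)
    show "herm (v0 - dv - v0) v0 = 0" using perp herm_diff_left[of 0 dv v0] by (simp add: perp_def)
    have "(mat l0 - A) *v (v0 - dv) = dl *s v0"
      using eq unfolding matrix_vector_mult_diff_distrib by (simp add: algebra_simps)
    then show "(mat l0 - A) *v (v0 - dv) = (l0 - (l0 - dl)) *s v0" by simp
  qed
qed

lemma proj_sin_herm_commute: "proj_sin herm x y = proj_sin herm y (x::'k::hermitian_scalar^'n)"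
  by (simp add: proj_sin_def norm_herm_commute[of x y] mult.commute)

lemma norm_pair_le_sqrt2:
  assumes "norm l \<le> norm A"
  shows "norm (A, l) \<le> sqrt 2 * norm A"
proof -
  have "(norm l)\<^sup>2 \<le> (norm A)\<^sup>2" using assms by (intro power_mono) auto
  then have "norm (A, l) \<le> sqrt (2 * (norm A)\<^sup>2)"
    unfolding norm_prod_def by simp
  then show ?thesis by (simp add: real_sqrt_mult)
qed

text \<open>
  Quadratic convergence with an explicit constant. Because \<open>eig_map A\<close> is quadratic, with the
  product of the two variables as its only nonlinear term, the error of the Newton step
  is exactly the inverse derivative applied to the vector \<open>(l0 - l) u\<close>, up to sign: equation \<open>eq\<close> in the proof.
  So \<open>norm e\<close> is bounded through \<open>inverse_bound_near_eigenvector\<close> by \<open>norm (l0 - l) * norm u\<close>, a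
  product of two first-order quantities, and the new eigenvalue error by
  \<open>norm_radial_part_le\<close>.
\<close>

lemma newton_step:
  fixes A :: "'k::hermitian_scalar^'n^'n"
  assumes wp: "(A, l, v) \<in> well_posed" and A: "A \<noteq> 0" and v0: "v0 \<noteq> 0"
    and small: "cond_number (A, l, v) * dist_P2 (A, l0, v0) (A, l, v) < 0.0739"
  shows "(l0, v0) \<in> newton_domain A" and "snd (newton A (l0, v0)) \<noteq> 0"
    and "dist_P2 (A, newton A (l0, v0)) (A, l, v)
      \<le> 6.7 * cond_number (A, l, v) * (dist_P2 (A, l0, v0) (A, l, v))\<^sup>2"
proof -
  define \<mu> d where "\<mu> = cond_number (A, l, v)" and "d = dist_P2 (A, l0, v0) (A, l, v)"
  define a sa where "a = proj_dist herm_pair (A, l0) (A, l)"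
    and "sa = proj_sin herm_pair (A, l0) (A, l)"
  define b sb where "b = proj_dist herm v0 v" and "sb = proj_sin herm v0 v"
  let ?N = "norm A" and ?r = "norm v0"
  have N: "?N > 0" and r: "?r > 0" using A v0 by auto
  have v: "v \<noteq> 0" and Av: "A *v v = l *s v"
    using wp by (auto simp: well_posed_def solution_variety_def mat_diff_mult_vec)
  have \<mu>: "1 \<le> \<mu>" by (simp add: \<mu>_def cond_number_def)
  have d: "d = sqrt (a\<^sup>2 + b\<^sup>2)" by (simp add: d_def a_def b_def dist_P2_def)
  have d0: "0 \<le> d" by (simp add: d)
  have \<mu>d: "\<mu> * d < 0.0739" using small by (simp add: \<mu>_def d_def)
  have d_small: "d \<le> 0.0739" using \<mu>d mult_right_mono[OF \<mu> d0] by simp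
  have ab_d: "a \<le> d" "b \<le> d" unfolding d by simp_all
  have sa: "0 \<le> sa" "sa \<le> a"
    unfolding sa_def a_def using herm_pair_Cauchy_Schwarz by (rule proj_dist_between_sines)+
  have sb: "0 \<le> sb" "sb \<le> b"
    unfolding sb_def b_def using herm_Cauchy_Schwarz by (rule proj_dist_between_sines)+
  (* If v and v0 were orthogonal, their angle would be far too large; so v can be scaled into
     the affine hyperplane through v0 orthogonal to v0, which also contains the new vector. *)
  have hv: "herm v v0 \<noteq> 0"
  proof
    assume "herm v v0 = 0"
    then have "sb = 1" by (simp add: sb_def proj_sin_def norm_herm_commute[of v0 v])
    then show False using sb ab_d d_small by simp
  qed
  define \<kappa> where "\<kappa> = herm v0 v0 / herm v v0"
  define u where "u = \<kappa> *s v - v0"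
  have u: "v0 + u = \<kappa> *s v" "herm u v0 = 0"
    using hv by (simp_all add: u_def herm_diff_left herm_scale_left \<kappa>_def)
  have nu: "norm u \<le> 1.01 * b * ?r"
  proof (rule tangent_from_angle)
    have "u = perp_proj v0 (v0 + u)"
      using u(2) by (simp add: perp_proj_add perp_proj_perp perp_def)
    then have "norm u = norm \<kappa> * norm (perp_proj v0 v)"
      unfolding u(1) by (simp add: perp_proj_scale norm_vector_smult)
    then show "norm u = norm (\<kappa> *s v) * sb"
      unfolding sb_def by (simp add: norm_vector_smult proj_sin_herm[OF v0 v, symmetric])
    show "(norm (\<kappa> *s v))\<^sup>2 = ?r\<^sup>2 + (norm u)\<^sup>2"
      unfolding u(1)[symmetric] add.commute[of v0 u] herm_Pythagoras[OF u(2)] by simp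
  qed (use r sb ab_d d_small in auto)
  have nl: "norm (l0 - l) \<le> 2.24 * ?N * a"
  proof (rule shift_from_angle[OF N])
    show "norm (A, l) * norm (A, l0) * sa = ?N * norm (l0 - l)"
      unfolding sa_def by (simp add: proj_sin_herm_pair[OF A, symmetric])
    have "norm ((A, l) + (0, l0 - l)) \<le> norm (A, l) + norm (0 :: 'k^'n^'n, l0 - l)"
      by (rule norm_triangle_ineq)
    then show "norm (A, l0) \<le> norm (A, l) + norm (l0 - l)" by (simp add: norm_Pair)
    show "norm (A, l) \<le> sqrt 2 * ?N"
      by (rule norm_pair_le_sqrt2[OF eigenvalue_norm_le[OF Av v]])
  qed (use sa ab_d d_small in auto)
  (* The relative errors are at most 2.24 d and 1.01 d, and 3.25 * 0.0739 + 1.01 * 0.0739 < 0.32. *)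
  have close: "\<mu> * (norm (l0 - l) / ?N + norm u / ?r) + norm u / ?r \<le> 0.32"
  proof -
    have "norm u / ?r \<le> 1.01 * b" using nu r by (simp add: divide_simps mult_ac)
    then have t: "norm u / ?r \<le> 1.01 * d" using ab_d by simp
    have "norm (l0 - l) / ?N \<le> 2.24 * a" using nl N by (simp add: divide_simps mult_ac)
    moreover have "p \<le> 2.24 * a \<Longrightarrow> q \<le> 1.01 * d \<Longrightarrow> p + q \<le> 3.25 * d" for p q
      using ab_d by simp
    ultimately have "norm (l0 - l) / ?N + norm u / ?r \<le> 3.25 * d" using t by blast
    then have "\<mu> * (norm (l0 - l) / ?N + norm u / ?r) \<le> \<mu> * (3.25 * d)"
      using \<mu> by (intro mult_left_mono) auto
    also have "\<dots> \<le> 0.2402" using \<mu>d by simp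
    finally show ?thesis using t d_small by simp
  qed
  note bound = inverse_bound_near_eigenvector[OF wp A v0 u close[unfolded \<mu>_def], folded \<mu>_def]
  show dom: "(l0, v0) \<in> newton_domain A"
  proof (rule newton_domainI[OF v0])
    fix e c assume "herm e v0 = 0" "(mat l0 - A) *v e = c *s v0"
    then have "0.68 * ?N * norm e \<le> \<mu> * norm (0 :: 'k^'n)"
      by (intro bound[where s = c]) simp_all
    then show "e = 0" using N by (simp add: mult_le_0_iff)
  qed
  obtain l1 v1 where step: "newton A (l0, v0) = (l1, v1)" "herm (v1 - v0) v0 = 0"
    "(mat l0 - A) *v v1 = (l0 - l1) *s v0"
    by (rule newton_characterization[OF dom])
  have rv1: "?r \<le> norm v1" using norm_le_add_perp[OF step(2)] by simp
  then have v1: "v1 \<noteq> 0" using r by auto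
  show "snd (newton A (l0, v0)) \<noteq> 0" using v1 by (simp add: step(1))
  define e where "e = v1 - \<kappa> *s v"
  have e: "herm e v0 = 0"
  proof -
    have "e = (v1 - v0) - u" by (simp add: e_def u_def)
    then show ?thesis using step(2) u(2) by (simp add: herm_diff_left[of "v1 - v0" u])
  qed
  have eq: "(mat l0 - A) *v e = (- (l0 - l)) *s u + (l - l1) *s v0"
  proof -
    have "(mat l0 - A) *v (\<kappa> *s v) = (l0 - l) *s (\<kappa> *s v)"
      unfolding mat_diff_mult_vec vec.linear_scale[OF matrix_vector_mul_linear_gen] Av
      by (simp add: vec_eq_iff algebra_simps)
    then have "(mat l0 - A) *v e = (l0 - l1) *s v0 - (l0 - l) *s (v0 + u)"
      unfolding e_def matrix_vector_mult_diff_distrib step(3) u(1) by simp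
    then show ?thesis by (simp add: vec_eq_iff algebra_simps)
  qed
  have y: "herm ((- (l0 - l)) *s u) v0 = 0"
    by (simp only: herm_scale_left u(2) mult_zero_right)
  (* The number x bounds the sines of both angles after the step. Each of the two distances is
     then at most 2 x and the combined one at most 4 x, whence the constant 1.675 = 6.7 / 4. *)
  define x where "x = norm e / ?r"
  have x0: "0 \<le> x" and ex: "norm e = x * ?r" using r by (simp_all add: x_def)
  have x: "x \<le> 1.675 * \<mu> * d\<^sup>2"
  proof -
    have "0.68 * ?N * norm e \<le> \<mu> * (norm (l0 - l) * norm u)"
      using bound[OF e y eq] by (simp only: norm_vector_smult norm_minus_cancel)
    also have "\<dots> \<le> \<mu> * ((2.24 * ?N * a) * (1.01 * b * ?r))"
      using \<mu> sa sb N r by (intro mult_left_mono mult_mono nl nu) auto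
    finally have "(?N * ?r) * (0.68 * x) \<le> (?N * ?r) * (2.2624 * (\<mu> * (a * b)))"
      unfolding ex by (simp add: mult_ac)
    then have "0.68 * x \<le> 2.2624 * (\<mu> * (a * b))"
      using N r by simp
    moreover have "2 * (a * b) \<le> d\<^sup>2"
      using sum_squares_bound[of a b] by (simp add: d)
    then have "\<mu> * (2 * (a * b)) \<le> \<mu> * d\<^sup>2" using \<mu> by (intro mult_left_mono) auto
    ultimately have "0.68 * x \<le> 1.1312 * (\<mu> * d\<^sup>2)" by simp
    moreover have "0 \<le> \<mu> * d\<^sup>2" using \<mu> by simp
    ultimately show ?thesis by simp
  qed
  define a1 b1 where "a1 = proj_dist herm_pair (A, l1) (A, l)" and "b1 = proj_dist herm v1 v"
  have b1: "0 \<le> b1" "b1 \<le> 2 * x"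
  proof -
    have "perp_proj v v1 = perp_proj v (\<kappa> *s v + e)" by (simp add: e_def)
    also have "\<dots> = perp_proj v e" by (simp only: perp_proj_add perp_proj_scale) simp
    finally have "norm v1 * proj_sin herm v1 v \<le> norm e"
      unfolding proj_sin_herm_commute[of v1 v] proj_sin_herm[OF v v1]
      using norm_perp_proj_le[OF v, of e] by simp
    moreover have "?r * proj_sin herm v1 v \<le> norm v1 * proj_sin herm v1 v"
      by (intro mult_right_mono rv1 proj_dist_between_sines(4) herm_Cauchy_Schwarz)
    ultimately have "proj_sin herm v1 v \<le> x" using r by (simp add: x_def field_simps)
    then show "0 \<le> b1" "b1 \<le> 2 * x"
      using proj_dist_between_sines(2,3)[of herm v1 v, OF herm_Cauchy_Schwarz] by (simp_all add: b1_def)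
  qed
  have a1: "0 \<le> a1" "a1 \<le> 2 * x"
  proof -
    let ?s = "proj_sin herm_pair (A, l1) (A, l)"
    have s0: "0 \<le> ?s" by (intro proj_dist_between_sines(4) herm_pair_Cauchy_Schwarz)
    have ge: "?N \<le> norm (A, k)" for k :: 'k using norm_fst_le[of A k] by simp
    have "?N * ?N * ?s \<le> norm (A, l1) * norm (A, l) * ?s"
      by (intro mult_right_mono mult_mono ge s0) auto
    also have "\<dots> = ?N * norm (l1 - l)" by (rule proj_sin_herm_pair[OF A])
    finally have "?N * ?s \<le> norm (l - l1)" using N by (simp add: mult.assoc norm_minus_commute)
    then have "(?N * ?s) * ?r \<le> norm (l - l1) * ?r" using r by (intro mult_right_mono) auto
    also have "\<dots> \<le> ?N * (x * ?r)"
      using norm_radial_part_le[OF v0 e y eq] by (simp add: ex)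
    finally have "?s \<le> x" using N r by simp
    then show "0 \<le> a1" "a1 \<le> 2 * x"
      using proj_dist_between_sines(2,3)[of herm_pair "(A, l1)" "(A, l)", OF herm_pair_Cauchy_Schwarz]
      by (simp_all add: a1_def)
  qed
  have "dist_P2 (A, l1, v1) (A, l, v) = sqrt (a1\<^sup>2 + b1\<^sup>2)"
    by (simp add: a1_def b1_def dist_P2_def)
  also have "\<dots> \<le> 4 * x"
    using sqrt_sum_squares_le_sum[OF a1(1) b1(1)] a1(2) b1(2) by simp
  also have "\<dots> \<le> 6.7 * \<mu> * d\<^sup>2"
    using x by simp
  finally show "dist_P2 (A, newton A (l0, v0)) (A, l, v)
      \<le> 6.7 * cond_number (A, l, v) * (dist_P2 (A, l0, v0) (A, l, v))\<^sup>2"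
    by (simp add: step(1) \<mu>_def d_def)
qed

section \<open>Iteration\<close>

text \<open>
  A step takes \<open>6.7 * \<mu> * D k\<close> to at most its square, and the initial value is less than
  \<open>6.7 * 0.0739 < 1 / 2\<close>. The distances never exceed the initial one, so \<open>newton_step\<close> remains
  applicable.
\<close>

theorem approx_solution_if_close:
  fixes A :: "'k::hermitian_scalar^'n^'n"
  assumes A: "A \<noteq> 0" and v0: "v0 \<noteq> 0" and wp: "(A, l, v) \<in> well_posed"
    and close: "dist_P2 (A, l0, v0) (A, l, v) < 0.0739 / cond_number (A, l, v)"
  shows "approx_solution A (l0, v0) (l, v)"
proof -
  define \<mu> where "\<mu> = cond_number (A, l, v)"
  define X where "X k = (newton A ^^ k) (l0, v0)" for k
  define D where "D k = dist_P2 (A, X k) (A, l, v)" for k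
  have \<mu>: "1 \<le> \<mu>" by (simp add: \<mu>_def cond_number_def)
  have D0: "0 \<le> D k" for k by (simp add: D_def dist_P2_def split: prod.split)
  have \<mu>D: "\<mu> * D 0 < 0.0739"
    using close \<mu> by (simp add: D_def X_def \<mu>_def[symmetric] field_simps)
  have step: "X k \<in> newton_domain A" "snd (X (Suc k)) \<noteq> 0" "D (Suc k) \<le> 6.7 * \<mu> * (D k)\<^sup>2"
    if "snd (X k) \<noteq> 0" "D k \<le> D 0" for k
  proof -
    obtain m w where X: "X k = (m, w)" by fastforce
    have "\<mu> * D k \<le> \<mu> * D 0" using that(2) \<mu> by (intro mult_left_mono) auto
    then have "\<mu> * D k < 0.0739" using \<mu>D by simp
    then have small: "cond_number (A, l, v) * dist_P2 (A, m, w) (A, l, v) < 0.0739"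
      by (simp add: D_def X \<mu>_def)
    have w: "w \<noteq> 0" using that(1) by (simp add: X)
    have XS: "X (Suc k) = newton A (m, w)" using X by (simp add: X_def)
    note n = newton_step[OF wp A w small]
    show "X k \<in> newton_domain A" "snd (X (Suc k)) \<noteq> 0" "D (Suc k) \<le> 6.7 * \<mu> * (D k)\<^sup>2"
      using n unfolding X XS D_def \<mu>_def by simp_all
  qed
  have main: "snd (X k) \<noteq> 0 \<and> D k \<le> (1/2) ^ (2 ^ k - 1) * D 0" for k
  proof (induction k)
    case 0
    then show ?case using v0 by (simp add: X_def)
  next
    case (Suc k)
    let ?q = "(1/2::real) ^ (2 ^ k - 1)"
    have "?q * D 0 \<le> 1 * D 0" by (intro mult_right_mono power_le_one D0) auto
    then have "D k \<le> D 0" using Suc.IH by simp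
    note s = step[OF conjunct1[OF Suc.IH] this]
    have "(D k)\<^sup>2 \<le> (?q * D 0)\<^sup>2" using Suc.IH D0 by (intro power_mono) auto
    then have "6.7 * \<mu> * (D k)\<^sup>2 \<le> 6.7 * \<mu> * (?q * D 0)\<^sup>2"
      using \<mu> by (intro mult_left_mono) auto
    then have "D (Suc k) \<le> 6.7 * \<mu> * (?q * D 0)\<^sup>2" using s(3) by simp
    also have "\<dots> = (6.7 * (\<mu> * D 0)) * (?q\<^sup>2 * D 0)" by (simp add: power2_eq_square)
    also have "\<dots> \<le> 1/2 * (?q\<^sup>2 * D 0)"
      using \<mu>D D0 by (intro mult_right_mono) auto
    also have "\<dots> = (1/2) ^ (2 ^ Suc k - 1) * D 0"
    proof -
      obtain m where "(2::nat) ^ k = Suc m"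
        using not0_implies_Suc[of "2 ^ k"] by auto
      then have "(2::nat) ^ Suc k - 1 = Suc ((2 ^ k - 1) * 2)" by simp
      then show ?thesis by (simp add: power_mult)
    qed
    finally show ?case using s(2) by blast
  qed
  have le: "D k \<le> D 0" for k
  proof -
    have "(1/2) ^ (2 ^ k - 1) * D 0 \<le> 1 * D 0" by (intro mult_right_mono power_le_one D0) auto
    then show ?thesis using main[of k] by simp
  qed
  show ?thesis
    unfolding approx_solution_def
  proof (intro conjI allI impI)
    show "(A, l, v) \<in> solution_variety" using wp by (simp add: well_posed_def)
    show "(newton A ^^ k) (l0, v0) \<in> newton_domain A" for k
      using step(1)[OF conjunct1[OF main] le] by (simp add: X_def)
    show "dist_P2 (A, (newton A ^^ k) (l0, v0)) (A, l, v)
        \<le> (1/2) ^ (2 ^ k - 1) * dist_P2 (A, l0, v0) (A, l, v)" for k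
      using conjunct2[OF main[of k]] by (simp add: D_def X_def)
  qed
qed

theorem theorem2:
  assumes "CARD('n::finite) \<ge> 2"
  shows "(\<forall>(A :: real^'n^'n) l v l0 v0.
            A \<noteq> 0 \<and> v \<noteq> 0 \<and> v0 \<noteq> 0 \<and> (A, l, v) \<in> well_posed \<and>
            dist_P2 (A, l0, v0) (A, l, v) < 0.0739 / cond_number (A, l, v)
            \<longrightarrow> approx_solution A (l0, v0) (l, v))
       \<and> (\<forall>(A :: complex^'n^'n) l v l0 v0.
            A \<noteq> 0 \<and> v \<noteq> 0 \<and> v0 \<noteq> 0 \<and> (A, l, v) \<in> well_posed \<and>
            dist_P2 (A, l0, v0) (A, l, v) < 0.0739 / cond_number (A, l, v)
            \<longrightarrow> approx_solution A (l0, v0) (l, v))"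
  by (intro conjI allI impI; elim conjE; rule approx_solution_if_close; assumption)

end
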